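(* Let $\chi$ be an odd primitive Dirichlet character (i.e. $\chi(-1)=-1$) with conductor $q>1$. Then for every complex number $z\neq 1$, $$\prod_{k=2}^\infty\left(1-\chi(k)\frac{z}{k}\right)=\frac{2^{\varphi(q)/2}}{(1-z)\,\epsilon(q)}\cdot\prod_{\substack{1\le j\le \lfloor (q-1)/2\rfloor\\ \gcd(j,q)=1}}\sin\left(\pi\,\frac{j-\chi(j)z}{q}\right),$$ where $\varphi$ is Euler's totient function and $\epsilon(q)=\sqrt{p}$ if $q$ is a power of a prime $p$, and $\epsilon(q)=1$ otherwise.
   Context: The infinite product denotes $\lim_{N\to\infty}\prod_{k=2}^N$ (the value $0$ is allowed). *)

theory Defs
  imports "HOL-Analysis.Analysis" "HOL-Number_Theory.Number_Theory"
begin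

definition dirichlet_char :: "nat \<Rightarrow> (int \<Rightarrow> complex) \<Rightarrow> bool" where
  "dirichlet_char q chi \<longleftrightarrow> q > 0 \<and>
     (\<forall>a b. chi (a * b) = chi a * chi b) \<and>
     (\<forall>a b. [a = b] (mod int q) \<longrightarrow> chi a = chi b) \<and>
     (\<forall>a. chi a \<noteq> 0 \<longleftrightarrow> coprime a (int q))"

definition induced_from :: "nat \<Rightarrow> (int \<Rightarrow> complex) \<Rightarrow> nat \<Rightarrow> bool" where
  "induced_from q chi d \<longleftrightarrow> d dvd q \<and>
     (\<exists>psi. dirichlet_char d psi \<and> (\<forall>a. coprime a (int q) \<longrightarrow> chi a = psi a))"

definition conductor :: "nat \<Rightarrow> (int \<Rightarrow> complex) \<Rightarrow> nat" where
  "conductor q chi = (LEAST d. induced_from q chi d)"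

definition primitive_dirichlet_char :: "nat \<Rightarrow> (int \<Rightarrow> complex) \<Rightarrow> bool" where
  "primitive_dirichlet_char q chi \<longleftrightarrow> dirichlet_char q chi \<and> conductor q chi = q"

text \<open>For a prime power, \<^const>\<open>aprimedivisor\<close> is its unique prime divisor.\<close>

definition prime_power_eps :: "nat \<Rightarrow> real" where
  "prime_power_eps q = (if primepow q then sqrt (real (aprimedivisor q)) else 1)"

lemma prime_power_eps_prime_power:
  assumes "prime p" "k > 0"
  shows "prime_power_eps (p ^ k) = sqrt (real p)"
proof -
  have "primepow (p ^ k)"
    using assms unfolding primepow_def by blast
  then show ?thesis
    using assms by (simp add: prime_power_eps_def aprimedivisor_prime_power)
qed

lemma prime_power_eps_not_prime_power:
  assumes "\<And>p k. prime p \<Longrightarrow> k > 0 \<Longrightarrow> q \<noteq> p ^ k"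
  shows "prime_power_eps q = 1"
  using assms by (auto simp: prime_power_eps_def primepow_def)

end

theory Submission
  imports Defs
begin

text \<open>
  Since \<open>\<chi>\<close> is odd, the factors at \<open>k = qm + j\<close> and \<open>k = qm - j\<close> of the product pair up to
  \<open>(1 - (a - w)\<^sup>2 / m\<^sup>2) / (1 - a\<^sup>2 / m\<^sup>2)\<close> with \<open>a = j / q\<close> and \<open>w = \<chi>(j) z / q\<close>. Euler's sine
  product therefore turns the residue classes of \<open>j\<close> and \<open>-j\<close> into
  \<open>sin (\<pi> (a - w)) / sin (\<pi> a)\<close>. The denominators are evaluated by taking logarithms: summed over
  the divisors \<open>d\<close> of \<open>n\<close>, the sums of \<open>ln (2 sin (\<pi> k / d))\<close> over the totatives \<open>k\<close> of \<open>d\<close> give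
  \<open>ln n\<close>, a relation which characterises the von Mangoldt function.
\<close>

section \<open>Products of sines over totatives\<close>

text \<open>The polynomial 1 + x + ... + x^(n-1) splits into the factors x - w over these w;
  evaluating it at 1 gives n.\<close>

lemma prod_one_minus_nontrivial_roots_unity:
  assumes "n > 0"
  shows "(\<Prod>w | w ^ n = 1 \<and> w \<noteq> 1. 1 - w) = (of_nat n :: complex)"
proof -
  define A where "A = {w :: complex. w ^ n = 1 \<and> w \<noteq> 1}"
  define p :: "complex poly" where "p = (\<Sum>i<n. Polynomial.monom 1 i)"
  define r where "r = (\<Prod>w\<in>A. [:- w, 1:])"
  have fin: "finite {w :: complex. w ^ n = 1}"
    using finite_roots_unity[of n] assms by simp
  have A: "finite A" "card A = n - 1"
  proof -
    have "A = {w. w ^ n = 1} - {1}" by (auto simp: A_def)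
    with fin assms show "finite A" "card A = n - 1"
      by (auto simp: card_roots_unity_eq)
  qed
  have coeff_p: "Polynomial.coeff p i = (if i < n then 1 else 0)" for i
    by (simp add: p_def coeff_sum)
  have deg_p: "Polynomial.degree p = n - 1"
  proof (rule antisym)
    show "Polynomial.degree p \<le> n - 1" by (rule degree_le) (auto simp: coeff_p)
    show "n - 1 \<le> Polynomial.degree p" by (rule le_degree) (use assms in \<open>auto simp: coeff_p\<close>)
  qed
  have deg_r: "Polynomial.degree r = n - 1"
    unfolding r_def by (subst degree_prod_eq_sum_degree) (auto simp: A)
  have lc_r: "lead_coeff r = 1"
    unfolding r_def by (simp add: lead_coeff_prod)
  have "p = r"
  \<comment> \<open>With equal coefficients in degree n - 1, the difference has smaller degree, so
    agreement at the n - 1 points of \<open>A\<close> forces equality.\<close>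
  proof (rule poly_eqI_degree_lead_coeff)
    show "Polynomial.coeff p (n - 1) = Polynomial.coeff r (n - 1)"
      using lc_r deg_r assms by (simp add: coeff_p)
  next
    fix w assume w: "w \<in> A"
    have "poly r w = 0" unfolding r_def poly_prod
      using A w by (intro prod_zero) auto
    moreover have "poly p w = 0"
      using w by (simp add: p_def A_def poly_sum poly_monom geometric_sum)
    ultimately show "poly p w = poly r w" by simp
  qed (use A deg_p deg_r in auto)
  hence "poly r 1 = poly p 1" by simp
  thus ?thesis by (simp add: r_def p_def poly_prod poly_sum poly_monom A_def)
qed

text \<open>Take norms in the product of 1 - w over the nontrivial roots of unity: the norm of 1 -
  \<open>cis (2 * t)\<close> is 2 sin t for t between 0 and pi.\<close>

lemma prod_two_sin_pi_over:
  assumes "n > 0"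
  shows "(\<Prod>k\<in>{0<..<n}. 2 * sin (pi * real k / real n)) = real n"
proof -
  let ?f = "\<lambda>k. cis (2 * pi * real k / real n)"
  have bij: "bij_betw ?f {..<n} {z. z ^ n = 1}"
    by (rule Complex.bij_betw_roots_unity) fact
  have "bij_betw ?f ({..<n} - {0}) ({z. z ^ n = 1} - {?f 0})"
    using assms by (intro bij_betw_DiffI bij) auto
  also have "{..<n} - {0} = {0<..<n}" by auto
  also have "{z. z ^ n = 1} - {?f 0} = {w. w ^ n = 1 \<and> w \<noteq> 1}" by auto
  finally have "(\<Prod>k\<in>{0<..<n}. 1 - ?f k) = of_nat n"
    using prod.reindex_bij_betw[of ?f "{0<..<n}" _ "\<lambda>w. 1 - w"]
      prod_one_minus_nontrivial_roots_unity[OF assms] by simp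
  hence "(\<Prod>k\<in>{0<..<n}. norm (1 - ?f k)) = real n"
    by (metis prod_norm norm_of_nat)
  moreover have "norm (1 - ?f k) = 2 * sin (pi * real k / real n)" if "k \<in> {0<..<n}" for k
  proof -
    define t where "t = pi * real k / real n"
    have "0 \<le> t" "t \<le> pi" using that by (auto simp: t_def field_simps)
    hence s: "sin t \<ge> 0" by (simp add: sin_ge_zero)
    have "1 - ?f k = 1 - cis (2 * t)" by (simp add: t_def mult.assoc)
    also have "\<dots> = - (2 * \<i> * of_real (sin t)) * cis t"
      by (simp add: complex_eq_iff cos_double_sin sin_double power2_eq_square)
    finally show ?thesis using s unfolding t_def[symmetric] by (simp add: norm_mult)
  qed
  ultimately show ?thesis by simp
qed

lemma sum_ln_two_sin_totatives:
  assumes "n > 0"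
  shows "(\<Sum>k\<in>totatives n. ln (2 * sin (pi * real k / real n))) = mangoldt n"
  using assms
proof (induction n rule: less_induct)
  case (less n)
  define g where "g = (\<lambda>n. \<Sum>k\<in>totatives n. ln (2 * sin (pi * real k / real n)))"
  have "(\<Sum>d | d dvd n. g d) = (\<Sum>d | d dvd n. g (n div d))"
    using less.prems by (intro sum.reindex_bij_witness[of _ "\<lambda>d. n div d" "\<lambda>d. n div d"]) auto
  \<comment> \<open>Sort the fractions k / n by reduced denominator: those with gcd k n = d are the
    fractions k' / (n / d) with k' a totative of n / d.\<close>
  also have "\<dots> = (\<Sum>d | d dvd n. \<Sum>k | k \<in> {0<..n} \<and> gcd k n = d. ln (2 * sin (pi * real k / real n)))"
  proof (intro sum.cong refl)
    fix d assume "d \<in> {d. d dvd n}"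
    hence d: "d dvd n" by simp
    with less.prems have "d > 0" by (auto intro: Nat.gr0I)
    show "g (n div d) = (\<Sum>k | k \<in> {0<..n} \<and> gcd k n = d. ln (2 * sin (pi * real k / real n)))"
      unfolding g_def
      using sum.reindex_bij_betw[OF bij_betw_totatives_gcd_eq[OF d less.prems],
          of "\<lambda>k. ln (2 * sin (pi * real k / real n))"] d \<open>d > 0\<close>
      by (simp add: real_of_nat_div field_simps)
  qed
  also have "\<dots> = (\<Sum>k\<in>{0<..n}. ln (2 * sin (pi * real k / real n)))"
    using less.prems by (intro sum.group) auto
  also have "{0<..n} = insert n {0<..<n}" using less.prems by auto
  \<comment> \<open>the term for \<^term>\<open>k = n\<close> is \<^term>\<open>ln 0 = (0 :: real)\<close>\<close>
  also have "(\<Sum>k\<in>insert n {0<..<n}. ln (2 * sin (pi * real k / real n))) =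
      (\<Sum>k\<in>{0<..<n}. ln (2 * sin (pi * real k / real n)))"
    using less.prems by simp
  also have "\<dots> = ln (\<Prod>k\<in>{0<..<n}. 2 * sin (pi * real k / real n))"
  proof (rule ln_prod [symmetric])
    fix k assume "k \<in> {0<..<n}"
    hence "sin (pi * real k / real n) > 0"
      by (intro sin_gt_zero) (auto simp: field_simps)
    thus "2 * sin (pi * real k / real n) \<noteq> 0" by simp
  qed simp
  also have "\<dots> = ln (real n)" using prod_two_sin_pi_over[OF less.prems] by simp
  also have "\<dots> = (\<Sum>d | d dvd n. mangoldt d)" using mangoldt_sum[of n, where ?'a = real] less.prems by simp
  finally have sums: "(\<Sum>d | d dvd n. g d) = (\<Sum>d | d dvd n. mangoldt d)" .
  have split: "{d. d dvd n} = insert n {d. d dvd n \<and> d < n}" "finite {d. d dvd n \<and> d < n}"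
    using less.prems by (auto dest: dvd_imp_le)
  \<comment> \<open>The induction hypothesis settles all proper divisors, so the two terms at d = n
    must agree as well.\<close>
  have "(\<Sum>d | d dvd n \<and> d < n. g d) = (\<Sum>d | d dvd n \<and> d < n. mangoldt d)"
    using less unfolding g_def by (intro sum.cong refl less.IH) (auto intro: Nat.gr0I)
  with sums split have "g n = mangoldt n" by simp
  thus ?case by (simp add: g_def)
qed

text \<open>Both sides are p for a power of a prime p, and 1 otherwise. The square appears because
  the totatives count every sine twice.\<close>

lemma exp_mangoldt: "exp (mangoldt q) = (prime_power_eps q)\<^sup>2"
proof (cases "primepow q")
  case True
  hence "prime (aprimedivisor q)"
    by (intro prime_aprimedivisor') (auto dest: primepow_gt_Suc_0)
  hence "aprimedivisor q > 0" by (rule prime_gt_0_nat)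
  with True show ?thesis by (simp add: mangoldt_def prime_power_eps_def)
qed (simp add: mangoldt_def prime_power_eps_def)

text \<open>Excludes the midpoint q / 2, the fixed point of the reflection j -> q - j: it divides q,
  so it could only be 1.\<close>

lemma coprime_imp_double_neq:
  assumes "q > 2" "coprime k (q :: nat)"
  shows "2 * k \<noteq> q"
proof
  assume q: "2 * k = q"
  hence "k dvd q" by auto
  with assms(2) have "k = 1" by (metis coprime_absorb_left nat_dvd_1_iff_1)
  with q assms(1) show False by simp
qed

lemma coprime_multiple_diff_iff:
  fixes q n j :: nat
  assumes "q dvd n" "j \<le> n"
  shows "coprime (n - j) q \<longleftrightarrow> coprime j q"
proof -
  have "d dvd n - j \<longleftrightarrow> d dvd j" if "d dvd q" for d
    using dvd_trans[OF that assms(1)] assms(2) by (metis dvd_diffD1 dvd_diff_nat)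
  thus ?thesis unfolding coprime_def by blast
qed

text \<open>Reflection j -> q - j preserves coprimality to q and swaps the two halves of the range;
  no totative lies at the midpoint since q > 2.\<close>

lemma totatives_eq_half_Un:
  assumes "q > 2"
  defines "J \<equiv> {j. 1 \<le> j \<and> j \<le> (q - 1) div 2 \<and> gcd j q = 1}"
  shows "totatives q = J \<union> (\<lambda>j. q - j) ` J" "J \<inter> (\<lambda>j. q - j) ` J = {}"
proof -
  have cop: "coprime (q - k) q \<longleftrightarrow> coprime k q" if "k \<le> q" for k
    using that by (intro coprime_multiple_diff_iff) auto
  show "totatives q = J \<union> (\<lambda>j. q - j) ` J"
  proof (intro equalityI subsetI)
    fix k assume k: "k \<in> totatives q"
    hence k': "0 < k" "k < q" "coprime k q"
      using assms totatives_less[of k q] by (auto simp: in_totatives_iff)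
    have "2 * k \<noteq> q" using coprime_imp_double_neq k' assms by blast
    show "k \<in> J \<union> (\<lambda>j. q - j) ` J"
    proof (cases "k \<le> (q - 1) div 2")
      case True
      thus ?thesis using k' by (auto simp: J_def)
    next
      case False
      hence "q - k \<in> J" using k' cop[of k] \<open>2 * k \<noteq> q\<close> by (auto simp: J_def)
      moreover have "k = q - (q - k)" using k' by simp
      ultimately show ?thesis by blast
    qed
  next
    fix k assume "k \<in> J \<union> (\<lambda>j. q - j) ` J"
    then obtain j where "j \<in> J" "k = j \<or> k = q - j" by blast
    moreover from this have "0 < j" "2 * j < q" "coprime j q"
      using assms by (auto simp: J_def gcd_eq_1_imp_coprime simp del: One_nat_def)
    ultimately show "k \<in> totatives q" using cop[of j] by (auto simp: in_totatives_iff)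
  qed
  show "J \<inter> (\<lambda>j. q - j) ` J = {}" using assms by (auto simp: J_def)
qed

text \<open>The sines at j and q - j coincide, so the product over all totatives, which is exp of
  \<open>mangoldt q\<close>, is the square of the half product. Positivity selects the root, and the
  phi(q) / 2 factors 2 make up the power of 2.\<close>

lemma prod_sin_half_totatives:
  assumes "q > 2"
  defines "J \<equiv> {j. 1 \<le> j \<and> j \<le> (q - 1) div 2 \<and> gcd j q = 1}"
  shows "2 powr (real (totient q) / 2) * (\<Prod>j\<in>J. sin (pi * real j / real q)) = prime_power_eps q"
proof -
  let ?s = "\<lambda>k. 2 * sin (pi * real k / real q)"
  have fin: "finite J" unfolding J_def by (rule finite_subset[of _ "{..q}"]) auto
  have J: "0 < j" "2 * j < q" if "j \<in> J" for j using that assms(1) by (auto simp: J_def)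
  have inj: "inj_on (\<lambda>j. q - j) J"
    using J by (intro inj_onI) fastforce
  note split = totatives_eq_half_Un[OF assms(1), folded J_def]
  have "totient q = 2 * card J"
    unfolding totient_def split(1) using fin split(2) inj
    by (subst card_Un_disjoint) (auto simp: card_image)
  hence pw: "2 powr (real (totient q) / 2) = 2 ^ card J"
    by (simp add: powr_realpow)
  have pos: "?s k > 0" if "0 < k" "k < q" for k
    using that by (intro mult_pos_pos sin_gt_zero) (auto simp: field_simps)
  have "(prime_power_eps q)\<^sup>2 = exp (\<Sum>k\<in>totatives q. ln (?s k))"
    using assms(1) by (simp add: sum_ln_two_sin_totatives exp_mangoldt)
  also have "\<dots> = (\<Prod>k\<in>totatives q. ?s k)"
    unfolding exp_sum[OF finite_totatives]
    using assms(1) totatives_less[of _ q]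
    by (intro prod.cong refl exp_ln pos) (auto simp: in_totatives_iff)
  also have "\<dots> = (\<Prod>j\<in>J. ?s j) * (\<Prod>j\<in>J. ?s (q - j))"
    unfolding split(1) using fin split(2) inj
    by (subst prod.union_disjoint) (auto simp: prod.reindex)
  also have "(\<Prod>j\<in>J. ?s (q - j)) = (\<Prod>j\<in>J. ?s j)"
  proof (intro prod.cong refl)
    fix j assume "j \<in> J"
    hence "pi * real (q - j) / real q = pi - pi * real j / real q"
      using J[of j] by (simp add: field_simps of_nat_diff)
    thus "?s (q - j) = ?s j" by simp
  qed
  finally have "(prime_power_eps q)\<^sup>2 = (\<Prod>j\<in>J. ?s j)\<^sup>2" by (simp add: power2_eq_square)
  moreover have "(\<Prod>j\<in>J. ?s j) \<ge> 0"
    using J by (intro prod_nonneg less_imp_le[OF pos]) fastforce+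
  moreover have "prime_power_eps q \<ge> 0" by (simp add: prime_power_eps_def)
  ultimately have "(\<Prod>j\<in>J. ?s j) = prime_power_eps q" by simp
  thus ?thesis by (simp add: pw prod.distrib)
qed

section \<open>Euler's sine product for a pair of residue classes\<close>

text \<open>Divide the partial Euler products of the two sines factor by factor. As a is not an
  integer, no denominator vanishes, and neither does the limit sin (pi a).\<close>

lemma sin_quotient_product:
  fixes a w :: complex
  assumes "a \<notin> \<int>"
  shows "(\<lambda>M. (1 - w / a) * (\<Prod>m=1..M. (1 - w / (of_nat m + a)) * (1 + w / (of_nat m - a))))
           \<longlonglongrightarrow> sin (of_real pi * (a - w)) / sin (of_real pi * a)"
proof -
  let ?S = "\<lambda>b M. of_real pi * b * (\<Prod>m=1..M. 1 - b\<^sup>2 / (of_nat m)\<^sup>2) :: complex"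
  have nz: "of_nat m + a \<noteq> 0" "of_nat m - a \<noteq> 0" for m :: nat
  proof -
    show "of_nat m + a \<noteq> 0"
      using assms by (metis Ints_minus Ints_of_nat add_eq_0_iff)
    show "of_nat m - a \<noteq> 0"
      using assms by (metis Ints_of_nat right_minus_eq)
  qed
  have sin_nz: "sin (of_real pi * a) \<noteq> 0"
  proof
    assume "sin (of_real pi * a) = 0"
    then obtain n :: int where "of_real pi * a = of_real (n * pi)"
      by (auto simp: sin_eq_0)
    hence "a = of_int n" by (simp add: field_simps)
    with assms show False by simp
  qed
  have "(\<lambda>M. ?S (a - w) M / ?S a M) \<longlonglongrightarrow> sin (of_real pi * (a - w)) / sin (of_real pi * a)"
    by (intro tendsto_divide sin_product_formula_complex sin_nz)
  also have "(\<lambda>M. ?S (a - w) M / ?S a M) =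
      (\<lambda>M. (1 - w / a) * (\<Prod>m=1..M. (1 - w / (of_nat m + a)) * (1 + w / (of_nat m - a))))"
  proof
    fix M
    have "?S (a - w) M / ?S a M =
        (a - w) / a * (\<Prod>m=1..M. (1 - (a - w)\<^sup>2 / (of_nat m)\<^sup>2) / (1 - a\<^sup>2 / (of_nat m)\<^sup>2))"
      by (simp add: prod_dividef)
    also have "(\<Prod>m=1..M. (1 - (a - w)\<^sup>2 / (of_nat m)\<^sup>2) / (1 - a\<^sup>2 / (of_nat m)\<^sup>2)) =
        (\<Prod>m=1..M. (1 - w / (of_nat m + a)) * (1 + w / (of_nat m - a)))"
    proof (intro prod.cong refl)
      fix m assume "m \<in> {1..M}"
      hence m: "of_nat m \<noteq> (0 :: complex)" by simp
      \<comment> \<open>Splitting the difference of squares for b = a - w and b = a lets m^2 cancel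
        in the quotient.\<close>
      have fac: "1 - b\<^sup>2 / (of_nat m)\<^sup>2 = (of_nat m + b) * (of_nat m - b) / (of_nat m)\<^sup>2" for b :: complex
        using m by (simp add: field_simps power2_eq_square)
      have "1 - w / (of_nat m + a) = (of_nat m + (a - w)) / (of_nat m + a)"
           "1 + w / (of_nat m - a) = (of_nat m - (a - w)) / (of_nat m - a)"
        using nz[of m] by (simp_all add: diff_divide_eq_iff add_divide_eq_iff algebra_simps)
      thus "(1 - (a - w)\<^sup>2 / (of_nat m)\<^sup>2) / (1 - a\<^sup>2 / (of_nat m)\<^sup>2) =
          (1 - w / (of_nat m + a)) * (1 + w / (of_nat m - a))"
        using m by (simp add: fac)
    qed
    also have "(a - w) / a = 1 - w / a" using nz[of 0] by (simp add: diff_divide_distrib)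
    finally show "?S (a - w) M / ?S a M =
        (1 - w / a) * (\<Prod>m=1..M. (1 - w / (of_nat m + a)) * (1 + w / (of_nat m - a)))" .
  qed
  finally show ?thesis .
qed

section \<open>Regrouping partial products by residue class\<close>

text \<open>With h = (q - 1) div 2, raising M by 1 appends q consecutive integers around n = q (M +
  1), from qM + h + 1 to n + h. Those coprime to q are exactly n + j and n - j for j in
  \<open>J\<close>.\<close>

lemma prod_coprime_support_by_half_residues:
  fixes f :: "nat \<Rightarrow> 'a :: comm_monoid_mult"
  assumes "q > 2" and f: "\<And>k. \<not> coprime k q \<Longrightarrow> f k = 1"
  defines "J \<equiv> {j. 1 \<le> j \<and> j \<le> (q - 1) div 2 \<and> gcd j q = 1}"
  shows "(\<Prod>k=1..q * M + (q - 1) div 2. f k) =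
           (\<Prod>j\<in>J. f j * (\<Prod>m=1..M. f (q * m + j) * f (q * m - j)))"
proof (induction M)
  case 0
  have "(\<Prod>k=1..(q - 1) div 2. f k) = (\<Prod>j\<in>J. f j)"
    by (intro prod.mono_neutral_right)
       (auto simp: J_def intro!: f)
  thus ?case by simp
next
  case (Suc M)
  define h where "h = (q - 1) div 2"
  define n where "n = q * Suc M"
  have h: "2 * h < q" "q \<le> 2 * h + 2" and n: "n \<ge> q" "n = q * M + q"
    using assms(1) by (auto simp: h_def n_def)
  have fin: "finite J" unfolding J_def by (rule finite_subset[of _ "{..q}"]) auto
  have J: "0 < j" "j \<le> h" "coprime j q" if "j \<in> J" for j
    using that by (auto simp: J_def h_def gcd_eq_1_imp_coprime simp del: One_nat_def)
  have "q dvd n" by (simp add: n_def)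
  have cop_plus: "coprime (n + j) q \<longleftrightarrow> coprime j q" for j
    unfolding coprime_def using dvd_trans[OF _ \<open>q dvd n\<close>] by (meson dvd_add_right_iff)
  have inj: "inj_on (\<lambda>j. n + j) J" "inj_on (\<lambda>j. n - j) J"
  proof -
    show "inj_on (\<lambda>j. n - j) J"
    proof (rule inj_onI)
      fix i j assume "i \<in> J" "j \<in> J" "n - i = n - j"
      thus "i = j" using J(2)[of i] J(2)[of j] h n(1) by linarith
    qed
  qed simp
  have disj: "(\<lambda>j. n + j) ` J \<inter> (\<lambda>j. n - j) ` J = {}"
  proof -
    have "n + i \<noteq> n - j" if "i \<in> J" for i j using J(1)[OF that] by linarith
    thus ?thesis by blast
  qed
  have "(\<Prod>k=q * M + h + 1..n + h. f k) = (\<Prod>k\<in>(\<lambda>j. n + j) ` J \<union> (\<lambda>j. n - j) ` J. f k)"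
  proof (intro prod.mono_neutral_right ballI)
    show "(\<lambda>j. n + j) ` J \<union> (\<lambda>j. n - j) ` J \<subseteq> {q * M + h + 1..n + h}"
    proof -
      have "n + j \<in> {q * M + h + 1..n + h}" "n - j \<in> {q * M + h + 1..n + h}" if "j \<in> J" for j
        using J(1,2)[OF that] h n by auto
      thus ?thesis by blast
    qed
    fix k assume k: "k \<in> {q * M + h + 1..n + h} - ((\<lambda>j. n + j) ` J \<union> (\<lambda>j. n - j) ` J)"
    show "f k = 1"
    proof (rule f, rule notI)
      assume cop: "coprime k q"
      consider "k > n" | "k = n" | "k < n" by linarith
      thus False
      proof cases
        case 1
        hence "k - n \<in> J" using cop k cop_plus[of "k - n"]
          by (auto simp: J_def h_def)
        moreover have "k = n + (k - n)" using 1 by simp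
        ultimately show False using k by blast
      next
        case 2
        with cop \<open>q dvd n\<close> have "is_unit q" using coprime_common_divisor[of k q q] by simp
        with assms(1) show False by simp
      next
        case 3
        have "coprime (n - k) q" using cop coprime_multiple_diff_iff[OF \<open>q dvd n\<close>, of k] 3 by simp
        \<comment> \<open>For even q the block starts at n - q / 2, whose distance from n exceeds h
          by one; coprimality rules this point out.\<close>
        moreover from this have "2 * (n - k) \<noteq> q"
          by (rule coprime_imp_double_neq[OF assms(1)])
        ultimately have "n - k \<in> J" using 3 k h n
          by (auto simp: J_def h_def[symmetric])
        moreover have "k = n - (n - k)" using 3 by simp
        ultimately show False using k by blast
      qed
    qed
  qed simp
  also have "\<dots> = (\<Prod>j\<in>J. f (n + j) * f (n - j))"
    using fin disj inj by (subst prod.union_disjoint) (auto simp: prod.reindex prod.distrib)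
  finally have step: "(\<Prod>k=q * M + h + 1..n + h. f k) = (\<Prod>j\<in>J. f (n + j) * f (n - j))" .
  have "{1..n + h} = {1..q * M + h} \<union> {q * M + h + 1..n + h}" using n by auto
  hence "(\<Prod>k=1..n + h. f k) = (\<Prod>k=1..q * M + h. f k) * (\<Prod>k=q * M + h + 1..n + h. f k)"
    by (simp add: prod.union_disjoint)
  thus ?case
    unfolding n_def[symmetric] h_def[symmetric] step Suc.IH[folded h_def]
    by (simp add: prod.distrib n_def mult_ac)
qed

text \<open>There are only finitely many classes, so one threshold M0 serves them all, and n \<ge> q
  M0 gives n div q \<ge> M0.\<close>

lemma LIMSEQ_residue_classes:
  fixes f :: "nat \<Rightarrow> 'a :: topological_space"
  assumes "q > 0" and lim: "\<And>s. s < q \<Longrightarrow> (\<lambda>M. f (q * M + s)) \<longlonglongrightarrow> L"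
  shows "f \<longlonglongrightarrow> L"
proof (rule topological_tendstoI)
  fix S assume "open S" "L \<in> S"
  hence "\<forall>s\<in>{..<q}. eventually (\<lambda>M. f (q * M + s) \<in> S) sequentially"
    using lim by (auto dest: topological_tendstoD)
  hence "eventually (\<lambda>M. \<forall>s\<in>{..<q}. f (q * M + s) \<in> S) sequentially"
    by (subst eventually_ball_finite_distrib) auto
  then obtain M0 where M0: "\<And>M s. M \<ge> M0 \<Longrightarrow> s < q \<Longrightarrow> f (q * M + s) \<in> S"
    by (auto simp: eventually_sequentially)
  show "eventually (\<lambda>n. f n \<in> S) sequentially"
    unfolding eventually_sequentially
  proof (intro exI allI impI)
    fix n assume "n \<ge> q * M0"
    hence "n div q \<ge> M0" using assms(1) by (simp add: less_eq_div_iff_mult_less_eq mult.commute)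
    from M0[OF this, of "n mod q"] show "f n \<in> S" using assms(1) by simp
  qed
qed

text \<open>Any other partial product arises from one ending at qM + h by a bounded number of
  further factors, each tending to 1.\<close>

lemma prod_LIMSEQ_of_residue_class:
  fixes f :: "nat \<Rightarrow> 'a :: real_normed_field"
  assumes "q > 0" and f: "f \<longlonglongrightarrow> 1"
    and lim: "(\<lambda>M. \<Prod>k=1..q * M + h. f k) \<longlonglongrightarrow> L"
  shows "(\<lambda>N. \<Prod>k=1..N. f k) \<longlonglongrightarrow> L"
\<comment> \<open>After the shift by h, the given limit is the class s = 0; induction on s appends
  one factor at a time.\<close>
proof (rule LIMSEQ_offset[where k = h], rule LIMSEQ_residue_classes[OF assms(1)])
  fix s
  show "(\<lambda>M. \<Prod>k=1..q * M + s + h. f k) \<longlonglongrightarrow> L"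
  proof (induction s)
    case (Suc s)
    have "filterlim (\<lambda>M. q * M + s + h + 1) sequentially sequentially"
      using assms(1) by (intro filterlim_subseq) (auto simp: strict_mono_def)
    hence "(\<lambda>M. f (q * M + s + h + 1)) \<longlonglongrightarrow> 1"
      by (rule filterlim_compose[OF f])
    from tendsto_mult[OF Suc.IH this] show ?case by simp
  qed (use lim in simp)
qed

section \<open>Products attached to odd characters\<close>

text \<open>Periodicity makes chi bounded, so chi(k) z / k tends to 0.\<close>

lemma dirichlet_char_prod_factor_LIMSEQ:
  assumes "dirichlet_char q chi"
  shows "(\<lambda>k. 1 - chi (int k) * (z / of_nat k)) \<longlonglongrightarrow> 1"
proof -
  \<comment> \<open>A crude bound suffices: the sum of the norms over one period dominates each of
    them.\<close>
  define B where "B = (\<Sum>s<q. norm (chi (int s)))"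
  have "q > 0" using assms by (simp add: dirichlet_char_def)
  have bound: "norm (chi (int k)) \<le> B" for k
  proof -
    have "[int k = int (k mod q)] (mod int q)" by (simp add: cong_def zmod_int)
    hence "chi (int k) = chi (int (k mod q))" using assms unfolding dirichlet_char_def by blast
    also have "norm \<dots> \<le> B" unfolding B_def
      using \<open>q > 0\<close> by (intro member_le_sum) auto
    finally show ?thesis .
  qed
  have "(\<lambda>k. chi (int k) * (z / of_nat k)) \<longlonglongrightarrow> 0"
  proof (rule Lim_null_comparison)
    show "\<forall>\<^sub>F k in sequentially. norm (chi (int k) * (z / of_nat k)) \<le> (B * norm z) / of_nat k"
    proof (intro always_eventually allI)
      fix k
      have "norm (chi (int k)) * (norm z / real k) \<le> B * (norm z / real k)"
        by (intro mult_right_mono bound) auto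
      thus "norm (chi (int k) * (z / of_nat k)) \<le> (B * norm z) / of_nat k"
        by (simp add: norm_mult norm_divide)
    qed
  qed (rule lim_const_over_n)
  from tendsto_diff[OF tendsto_const[of 1] this] show ?thesis by simp
qed

text \<open>Along the indices qM + (q - 1) div 2 the partial product is a product over the fixed
  finite set \<open>J\<close>, and each of its factors converges to a quotient of sines.\<close>

lemma odd_dirichlet_char_prod_LIMSEQ:
  assumes chi: "dirichlet_char q chi" and odd: "chi (-1) = -1" and q: "q > 2"
  defines "J \<equiv> {j. 1 \<le> j \<and> j \<le> (q - 1) div 2 \<and> gcd j q = 1}"
  shows "(\<lambda>N. \<Prod>k=1..N. (1 - chi (int k) * (z / of_nat k))) \<longlonglongrightarrow>
    (\<Prod>j\<in>J. sin (of_real pi * ((of_nat j - chi (int j) * z) / of_nat q)) /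
            sin (of_real pi * (of_nat j / of_nat q)))"
proof (rule prod_LIMSEQ_of_residue_class)
  show "q > 0" using q by simp
  show "(\<lambda>k. 1 - chi (int k) * (z / of_nat k)) \<longlonglongrightarrow> 1"
    using chi by (rule dirichlet_char_prod_factor_LIMSEQ)
  let ?f = "\<lambda>k. 1 - chi (int k) * (z / of_nat k)"
  have cong: "chi a = chi b" if "[a = b] (mod int q)" for a b
    using chi that unfolding dirichlet_char_def by blast
  have mult: "chi (a * b) = chi a * chi b" for a b
    using chi unfolding dirichlet_char_def by blast
  have zero: "?f k = 1" if "\<not> coprime k q" for k
  proof -
    have "\<not> coprime (int k) (int q)" using that by simp
    hence "chi (int k) = 0" using chi unfolding dirichlet_char_def by blast
    thus ?thesis by simp
  qed
  have "(\<lambda>M. ?f j * (\<Prod>m=1..M. ?f (q * m + j) * ?f (q * m - j))) \<longlonglongrightarrow>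
      sin (of_real pi * ((of_nat j - chi (int j) * z) / of_nat q)) /
      sin (of_real pi * (of_nat j / of_nat q))" if "j \<in> J" for j
  proof -
    have j: "0 < j" "j < q" using that q by (auto simp: J_def)
    define a :: complex where "a = of_nat j / of_nat q"
    define w where "w = chi (int j) * z / of_nat q"
    have "a \<notin> \<int>"
    proof
      assume "a \<in> \<int>"
      then obtain n where "a = of_int n" by (auto elim: Ints_cases)
      hence "of_nat j = (of_int n * of_nat q :: complex)" using q by (simp add: a_def field_simps)
      hence "(of_int (int j) :: complex) = of_int (n * int q)" by simp
      hence "int j = n * int q" by (simp only: of_int_eq_iff)
      hence "int q dvd int j" by simp
      with j show False by (auto dest: dvd_imp_le)
    qed
    have "?f j = 1 - w / a" using q by (simp add: a_def w_def)
    moreover have "?f (q * m + j) = 1 - w / (of_nat m + a)" for m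
    proof -
      have "chi (int (q * m + j)) = chi (int j)" by (rule cong) (simp add: cong_def)
      moreover have "of_nat (q * m + j) = of_nat q * (of_nat m + a)"
        using q by (simp add: a_def field_simps)
      ultimately show ?thesis using q by (simp add: w_def)
    qed
    moreover have "?f (q * m - j) = 1 + w / (of_nat m - a)" if "m \<ge> 1" for m
    proof -
      \<comment> \<open>For m \<ge> 1 the natural subtraction q m - j is a true one. Then q m - j is
        congruent to -j, and oddness of chi turns the minus sign into a plus.\<close>
      have "q * 1 \<le> q * m" using that by (intro mult_le_mono2)
      hence le: "j \<le> q * m" using j by linarith
      have "chi (int (q * m - j)) = chi (- 1 * int j)"
        by (rule cong) (use le in \<open>simp add: cong_iff_dvd_diff of_nat_diff\<close>)
      hence "chi (int (q * m - j)) = - chi (int j)"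
        by (simp only: mult odd) simp
      moreover have "of_nat (q * m - j) = of_nat q * (of_nat m - a)"
        using q le by (simp add: a_def field_simps of_nat_diff)
      ultimately show ?thesis using q by (simp add: w_def)
    qed
    ultimately have "(\<lambda>M. ?f j * (\<Prod>m=1..M. ?f (q * m + j) * ?f (q * m - j))) =
        (\<lambda>M. (1 - w / a) * (\<Prod>m=1..M. (1 - w / (of_nat m + a)) * (1 + w / (of_nat m - a))))"
      by (intro ext arg_cong2[of _ _ _ _ "(*)"] prod.cong) auto
    moreover have "(of_nat j - chi (int j) * z) / of_nat q = a - w"
      by (simp add: a_def w_def diff_divide_distrib)
    ultimately show ?thesis
      using sin_quotient_product[OF \<open>a \<notin> \<int>\<close>, of w] by (simp only: a_def[symmetric])
  qed
  hence "(\<lambda>M. \<Prod>j\<in>J. ?f j * (\<Prod>m=1..M. ?f (q * m + j) * ?f (q * m - j))) \<longlonglongrightarrow>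
      (\<Prod>j\<in>J. sin (of_real pi * ((of_nat j - chi (int j) * z) / of_nat q)) /
              sin (of_real pi * (of_nat j / of_nat q)))"
    by (rule tendsto_prod)
  moreover have "(\<Prod>k=1..q * M + (q - 1) div 2. ?f k) =
      (\<Prod>j\<in>J. ?f j * (\<Prod>m=1..M. ?f (q * m + j) * ?f (q * m - j)))" for M
    unfolding J_def using q zero by (rule prod_coprime_support_by_half_residues)
  ultimately show "(\<lambda>M. \<Prod>k=1..q * M + (q - 1) div 2. ?f k) \<longlonglongrightarrow>
      (\<Prod>j\<in>J. sin (of_real pi * ((of_nat j - chi (int j) * z) / of_nat q)) /
              sin (of_real pi * (of_nat j / of_nat q)))"
    by (simp only:)
qed

theorem theorem2:
  fixes q :: nat and chi :: "int \<Rightarrow> complex" and z :: complex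
  assumes "primitive_dirichlet_char q chi" and "q > 1"
    and "chi (-1) = -1"
    and "z \<noteq> 1"
  shows "(\<lambda>N. \<Prod>k=2..N. (1 - chi (int k) * (z / of_nat k))) \<longlonglongrightarrow>
    complex_of_real (2 powr (real (totient q) / 2)) / ((1 - z) * complex_of_real (prime_power_eps q)) *
    (\<Prod>j | 1 \<le> j \<and> j \<le> (q - 1) div 2 \<and> gcd j q = 1.
       sin (complex_of_real pi * ((of_nat j - chi (int j) * z) / of_nat q)))"
proof -
  let ?f = "\<lambda>k. 1 - chi (int k) * (z / of_nat k)"
  define J where "J = {j. 1 \<le> j \<and> j \<le> (q - 1) div 2 \<and> gcd j q = 1}"
  define T where "T = (\<Prod>j\<in>J. sin (complex_of_real pi * ((of_nat j - chi (int j) * z) / of_nat q)))"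
  define S where "S = (\<Prod>j\<in>J. sin (pi * real j / real q))"
  have chi: "dirichlet_char q chi"
    using assms(1) by (simp add: primitive_dirichlet_char_def)
  have "chi 1 = chi (-1) * chi (-1)"
    using chi unfolding dirichlet_char_def by (metis mult_minus_left mult_1 minus_minus)
  hence chi_1: "chi 1 = 1" using assms(3) by simp
  \<comment> \<open>Modulo 2, -1 and 1 coincide, which contradicts oddness.\<close>
  have "q \<noteq> 2"
  proof
    assume "q = 2"
    hence "[-1 = 1] (mod int q)" by (simp add: cong_def)
    hence "chi (-1) = chi 1" using chi unfolding dirichlet_char_def by blast
    thus False using assms(3) chi_1 by simp
  qed
  hence q: "q > 2" using assms(2) by simp
  \<comment> \<open>This evaluates the denominators: 1 / S is the power of 2 divided by
    epsilon(q).\<close>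
  have eps: "2 powr (real (totient q) / 2) * S = prime_power_eps q"
    unfolding S_def J_def using q by (rule prod_sin_half_totatives)
  have "S > 0" unfolding S_def
    by (intro prod_pos ballI sin_gt_zero) (use q in \<open>auto simp: J_def field_simps\<close>)
  have "complex_of_real S = (\<Prod>j\<in>J. sin (of_real pi * (of_nat j / of_nat q)))"
    unfolding S_def of_real_prod by (simp add: sin_of_real[symmetric])
  hence lim: "(\<lambda>N. \<Prod>k=1..N. ?f k) \<longlonglongrightarrow> T / of_real S"
    using odd_dirichlet_char_prod_LIMSEQ[OF chi assms(3) q, of z, folded J_def]
    by (simp add: prod_dividef T_def)
  \<comment> \<open>The factor at k = 1 is 1 - z, as chi(1) = 1. It is nonzero and can be divided
    out once N \<ge> 1.\<close>
  have "\<forall>\<^sub>F N in sequentially. (\<Prod>k=1..N. ?f k) / (1 - z) = (\<Prod>k=2..N. ?f k)"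
    using eventually_ge_at_top[of 1]
  proof eventually_elim
    case (elim N)
    hence "(\<Prod>k=1..N. ?f k) = ?f 1 * (\<Prod>k=2..N. ?f k)"
      by (subst prod.atLeast_Suc_atMost) (simp_all add: numeral_2_eq_2)
    thus ?case using assms(4) chi_1 by simp
  qed
  moreover have "(\<lambda>N. (\<Prod>k=1..N. ?f k) / (1 - z)) \<longlonglongrightarrow> T / of_real S / (1 - z)"
    using lim assms(4) by (intro tendsto_divide tendsto_const) auto
  ultimately have "(\<lambda>N. \<Prod>k=2..N. ?f k) \<longlonglongrightarrow> T / of_real S / (1 - z)"
    by (rule Lim_transform_eventually[rotated])
  also have "T / of_real S / (1 - z) =
      complex_of_real (2 powr (real (totient q) / 2)) / ((1 - z) * complex_of_real (prime_power_eps q)) * T"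
    unfolding eps[symmetric] using \<open>S > 0\<close> assms(4) by (simp add: field_simps)
  finally show ?thesis by (simp only: T_def J_def)
qed

end
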